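(* Let $A=(a_{ij}),B=(b_{ij})\in\mathbb{R}^{m\times n}$ be a bimatrix game, and let $(x(t),y(t))_{t\ge 0}$ be any fictitious play trajectory of $(A,B)$, with empirical joint distribution $P(t)=(p_{ij}(t))$, $p_{ij}(t)=\frac1t\int_0^t x_i(s)y_j(s)\,ds$. Let $\mathcal{C}$ be the set of joint probability distributions $P=(p_{ij})$ over $\{1,\dots,m\}\times\{1,\dots,n\}$ such that for all $(i',j')\in\{1,\dots,m\}\times\{1,\dots,n\}$ $$\sum_{i,j} a_{i'j}\,p_{ij}\le \sum_{i,j} a_{ij}\,p_{ij}\quad\text{and}\quad \sum_{i,j} b_{ij'}\,p_{ij}\le\sum_{i,j} b_{ij}\,p_{ij},$$ and such that for at least one $(i',j')$ both of these hold with equality. Then $P(t)$ converges to the set $\mathcal{C}$ as $t\to\infty$, i.e. $\operatorname{dist}(P(t),\mathcal{C})\to 0$. In other words, fictitious play converges to a subset of the set of coarse correlated equilibria, and asymptotically leads to non-positive (unconditional) regret for both players: for all $i'$ and $j'$, $\limsup_{t\to\infty}\big(\sum_{i,j}a_{i'j}p_{ij}(t)-\sum_{i,j}a_{ij}p_{ij}(t)\big)\le 0$ and $\limsup_{t\to\infty}\big(\sum_{i,j}b_{ij'}p_{ij}(t)-\sum_{i,j}b_{ij}p_{ij}(t)\big)\le 0$.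
   Context: Mixed strategies of player A are row vectors in the simplex $\Sigma^A\subset\mathbb{R}^{1\times m}$; mixed strategies of player B are column vectors in the simplex $\Sigma^B\subset\mathbb{R}^{n\times 1}$. Best response correspondences: $BR_A(q)=\operatorname{argmax}_{\bar p\in\Sigma^A}\bar pAq$ for $q\in\Sigma^B$, and $BR_B(p)=\operatorname{argmax}_{\bar q\in\Sigma^B}pB\bar q$ for $p\in\Sigma^A$. A (continuous-time) fictitious play trajectory consists of measurable functions $x:[0,\infty)\to\Sigma^A$, $y:[0,\infty)\to\Sigma^B$ such that, with $p(t)=\frac1t\int_0^t x(s)\,ds$ and $q(t)=\frac1t\int_0^t y(s)\,ds$, one has $x(t)\in BR_A(q(t))$ and $y(t)\in BR_B(p(t))$ for $t\ge1$; the values $(x(t),y(t))\in\Sigma^A\times\Sigma^B$ for $0\le t<1$ are arbitrary. Then $(p(t),q(t))$, $t\ge1$, solves $\dot p\in\frac1t(BR_A(q)-p)$, $\dot q\in\frac1t(BR_B(p)-q)$. A joint probability distribution satisfying the two displayed families of inequalities is called a coarse correlated equilibrium (CCE). The distance is any norm distance on $\mathbb{R}^{m\times n}$. *)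

theory Defs
  imports "HOL-Analysis.Analysis"
begin

definition mixed :: "(real ^ 'k) set" where
  "mixed = {p. (\<forall>k. 0 \<le> p $ k) \<and> (\<Sum>k\<in>UNIV. p $ k) = 1}"

text \<open>
  An \<open>m \<times> n\<close> matrix is an element of \<open>real ^ 'n ^ 'm\<close>; \<open>payoff M p q\<close> is \<open>p M q\<close> for a row
  vector \<open>p\<close> and a column vector \<open>q\<close>.
\<close>

definition payoff :: "real ^ 'n ^ 'm \<Rightarrow> real ^ 'm \<Rightarrow> real ^ 'n \<Rightarrow> real" where
  "payoff M p q = p \<bullet> (M *v q)"

definition BR_A :: "real ^ 'n ^ 'm \<Rightarrow> real ^ 'n \<Rightarrow> (real ^ 'm) set" where
  "BR_A A q = {p. is_arg_max (\<lambda>p'. payoff A p' q) (\<lambda>p'. p' \<in> mixed) p}"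

definition BR_B :: "real ^ 'n ^ 'm \<Rightarrow> real ^ 'm \<Rightarrow> (real ^ 'n) set" where
  "BR_B B p = {q. is_arg_max (\<lambda>q'. payoff B p q') (\<lambda>q'. q' \<in> mixed) q}"

definition time_avg :: "(real \<Rightarrow> real ^ 'k) \<Rightarrow> real \<Rightarrow> real ^ 'k" where
  "time_avg x t = (1 / t) *\<^sub>R (LINT s|lebesgue_on {0..t}. x s)"

text \<open>
  Trajectories are indexed by \<open>[0, \<infinity>)\<close>; values at negative times are unconstrained and irrelevant.
  Measurability is Lebesgue measurability, which covers Borel measurable trajectories as well.
\<close>

definition fictitious_play ::
    "real ^ 'n ^ 'm \<Rightarrow> real ^ 'n ^ 'm \<Rightarrow> (real \<Rightarrow> real ^ 'm) \<Rightarrow> (real \<Rightarrow> real ^ 'n) \<Rightarrow> bool" where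
  "fictitious_play A B x y \<longleftrightarrow>
     x \<in> borel_measurable (lebesgue_on {0..}) \<and>
     y \<in> borel_measurable (lebesgue_on {0..}) \<and>
     (\<forall>t\<ge>0. x t \<in> mixed \<and> y t \<in> mixed) \<and>
     (\<forall>t\<ge>1. x t \<in> BR_A A (time_avg y t) \<and> y t \<in> BR_B B (time_avg x t))"

definition empirical_joint ::
    "(real \<Rightarrow> real ^ 'm) \<Rightarrow> (real \<Rightarrow> real ^ 'n) \<Rightarrow> real \<Rightarrow> real ^ 'n ^ 'm" where
  "empirical_joint x y t = (\<chi> i j. (1 / t) * (LINT s|lebesgue_on {0..t}. x s $ i * y s $ j))"

definition joint_dist :: "(real ^ 'n ^ 'm) set" where
  "joint_dist = {P. (\<forall>i j. 0 \<le> P $ i $ j) \<and> (\<Sum>i\<in>UNIV. \<Sum>j\<in>UNIV. P $ i $ j) = 1}"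

definition regret_A :: "real ^ 'n ^ 'm \<Rightarrow> 'm \<Rightarrow> real ^ 'n ^ 'm \<Rightarrow> real" where
  "regret_A A i' P =
     (\<Sum>i\<in>UNIV. \<Sum>j\<in>UNIV. A $ i' $ j * P $ i $ j) - (\<Sum>i\<in>UNIV. \<Sum>j\<in>UNIV. A $ i $ j * P $ i $ j)"

definition regret_B :: "real ^ 'n ^ 'm \<Rightarrow> 'n \<Rightarrow> real ^ 'n ^ 'm \<Rightarrow> real" where
  "regret_B B j' P =
     (\<Sum>i\<in>UNIV. \<Sum>j\<in>UNIV. B $ i $ j' * P $ i $ j) - (\<Sum>i\<in>UNIV. \<Sum>j\<in>UNIV. B $ i $ j * P $ i $ j)"

definition CCE :: "real ^ 'n ^ 'm \<Rightarrow> real ^ 'n ^ 'm \<Rightarrow> (real ^ 'n ^ 'm) set" where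
  "CCE A B = {P \<in> joint_dist. \<forall>i' j'.
     (\<Sum>i\<in>UNIV. \<Sum>j\<in>UNIV. A $ i' $ j * P $ i $ j) \<le> (\<Sum>i\<in>UNIV. \<Sum>j\<in>UNIV. A $ i $ j * P $ i $ j) \<and>
     (\<Sum>i\<in>UNIV. \<Sum>j\<in>UNIV. B $ i $ j' * P $ i $ j) \<le> (\<Sum>i\<in>UNIV. \<Sum>j\<in>UNIV. B $ i $ j * P $ i $ j)}"

definition FP_limit_set :: "real ^ 'n ^ 'm \<Rightarrow> real ^ 'n ^ 'm \<Rightarrow> (real ^ 'n ^ 'm) set" where
  "FP_limit_set A B = {P \<in> CCE A B. \<exists>i' j'.
     (\<Sum>i\<in>UNIV. \<Sum>j\<in>UNIV. A $ i' $ j * P $ i $ j) = (\<Sum>i\<in>UNIV. \<Sum>j\<in>UNIV. A $ i $ j * P $ i $ j) \<and>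
     (\<Sum>i\<in>UNIV. \<Sum>j\<in>UNIV. B $ i $ j' * P $ i $ j) = (\<Sum>i\<in>UNIV. \<Sum>j\<in>UNIV. B $ i $ j * P $ i $ j)}"

definition is_norm :: "('v::real_vector \<Rightarrow> real) \<Rightarrow> bool" where
  "is_norm N \<longleftrightarrow>
     (\<forall>v. 0 \<le> N v) \<and> (\<forall>v. N v = 0 \<longleftrightarrow> v = 0) \<and>
     (\<forall>c v. N (c *\<^sub>R v) = \<bar>c\<bar> * N v) \<and> (\<forall>v w. N (v + w) \<le> N v + N w)"

text \<open>
  Distance to a set in the norm \<open>N\<close>. It takes values in \<open>ereal\<close> so that the distance to the empty
  set is \<open>\<infinity>\<close>; with \<open>infdist\<close> it would be \<open>0\<close>, and convergence to the empty set would hold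
  vacuously.
\<close>

definition norm_setdist :: "('v::real_vector \<Rightarrow> real) \<Rightarrow> 'v \<Rightarrow> 'v set \<Rightarrow> ereal" where
  "norm_setdist N v S = (INF w\<in>S. ereal (N (v - w)))"

end

theory Submission
  imports Defs
begin

text \<open>
  With \<open>Y(t) = \<integral>\<^sub>0\<^sup>t y\<close>, let \<open>F(t) = max\<^sub>i (A Y(t))\<^sub>i\<close>. For \<open>t \<ge> 1\<close> we have \<open>F(t) = x(t) \<bullet> A Y(t)\<close>, and
  \<open>x(s) \<bullet> A (Y(t) - Y(s)) \<le> F(t) - F(s)\<close>: the best reply is a subgradient of the maximal payoff along
  the trajectory. Hence \<open>F(t) - F(2) = \<integral>\<^sub>2\<^sup>t x \<bullet> A y\<close>, so \<open>t\<close> times the maximal regret of player A at time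
  \<open>t\<close> is constant for \<open>t \<ge> 2\<close>, and the maximal regret tends to 0. Player B is the same statement for
  the transposed matrix with the players exchanged. Both maximal regrets are continuous on the compact
  set of joint distributions, and the limit set contains their common zero set, so the empirical
  joint distribution approaches it.
\<close>

section \<open>One-sided averages and integrals of subgradients\<close>

text \<open>The sequence is the right difference quotient of \<open>integral {a..t} F\<close> at
  \<open>t = a\<close>, read along the steps \<open>1 / (n + 1)\<close>, so the fundamental theorem
  of calculus gives its limit.\<close>

lemma right_average_tendsto:
  fixes F :: "real \<Rightarrow> real"
  assumes "continuous_on {a..a + 1} F"
  shows "(\<lambda>n. real (Suc n) * integral {a..a + inverse (real (Suc n))} F) \<longlonglongrightarrow> F a"
proof -
  have "((\<lambda>t. integral {a..t} F) has_real_derivative F a) (at a within {a..a + 1})"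
    using assms by (intro integral_has_real_derivative) auto
  then have D: "((\<lambda>t. integral {a..t} F / (t - a)) \<longlongrightarrow> F a) (at a within {a..a + 1})"
    by (simp add: has_field_derivative_iff)
  have "filterlim (\<lambda>n. a + inverse (real (Suc n))) (at a within {a..a + 1}) sequentially"
    unfolding filterlim_at
    using tendsto_add[OF tendsto_const LIMSEQ_inverse_real_of_nat, of a]
    by (auto simp: field_simps)
  from filterlim_compose[OF D this] show ?thesis
    by (simp add: divide_inverse mult.commute)
qed

text \<open>Shifting the variable makes the integral telescope: with step \<open>h\<close>,
  everything cancels except the averages of \<open>F\<close> over \<open>{d..d + h}\<close> and
  \<open>{c..c + h}\<close>. The unit of room beyond \<open>d\<close> accommodates every step
  \<open>h\<close>, since \<open>h\<close> is at most 1.\<close>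

lemma integral_right_differences_tendsto:
  fixes F :: "real \<Rightarrow> real"
  assumes "c \<le> d" and cont: "continuous_on {c..d + 1} F"
  shows "(\<lambda>n. integral {c..d} (\<lambda>s. real (Suc n) * (F (s + inverse (real (Suc n))) - F s)))
           \<longlonglongrightarrow> F d - F c"
proof -
  have int: "F integrable_on {s..t}" if "c \<le> s" "t \<le> d + 1" for s t
    using that by (intro integrable_continuous_real continuous_on_subset[OF cont]) auto
  have eq: "integral {c..d} (\<lambda>s. real (Suc n) * (F (s + inverse (real (Suc n))) - F s)) =
      real (Suc n) * integral {d..d + inverse (real (Suc n))} F -
      real (Suc n) * integral {c..c + inverse (real (Suc n))} F" for n
  proof -
    define h where "h = inverse (real (Suc n))"
    have h: "0 < h" "h \<le> 1" by (auto simp: h_def field_simps)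
    have "(\<lambda>s. F (s + h)) integrable_on {c..d}"
      using integrable_shift_real_ivl[OF int[of "c + h" "d + h"], of h] h by simp
    then have "integral {c..d} (\<lambda>s. real (Suc n) * (F (s + h) - F s)) =
        real (Suc n) * (integral {c..d} (\<lambda>s. F (s + h)) - integral {c..d} F)"
      using int[of c d] by (simp add: integral_diff)
    also have "integral {c..d} (\<lambda>s. F (s + h)) = integral {c + h..d + h} F"
      using integral_shift_real_ivl[of "c + h" h "d + h" F] by simp
    also have "\<dots> - integral {c..d} F = integral {d..d + h} F - integral {c..c + h} F"
      using Henstock_Kurzweil_Integration.integral_combine[OF _ _ int, of c "c + h" "d + h"]
        Henstock_Kurzweil_Integration.integral_combine[OF _ _ int, of c d "d + h"] h \<open>c \<le> d\<close> by simp
    finally show ?thesis by (simp add: h_def algebra_simps)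
  qed
  show ?thesis
    unfolding eq using \<open>c \<le> d\<close>
    by (intro tendsto_diff right_average_tendsto continuous_on_subset[OF cont]) auto
qed

text \<open>One-sided Lebesgue differentiation for vector-valued functions, localised to an
  interval: extending \<open>w\<close> by zero gives a function integrable on every box, and for
  \<open>s\<close> in \<open>{c..d}\<close> the averaging intervals never reach the region where the
  extension differs from \<open>w\<close>.\<close>

lemma right_average_tendsto_ae:
  fixes w :: "real \<Rightarrow> 'a::euclidean_space"
  assumes w: "w integrable_on {c..d + 1}"
  obtains N where "negligible N"
    "\<And>s. s \<in> {c..d} - N \<Longrightarrow>
      (\<lambda>n. real (Suc n) *\<^sub>R integral {s..s + inverse (real (Suc n))} w) \<longlonglongrightarrow> w s"
proof -
  define w' where "w' s = (if s \<in> {c..d + 1} then w s else 0)" for s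
  have "w' integrable_on UNIV"
    using w by (simp only: w'_def[abs_def] integrable_restrict_UNIV)
  then have "w' integrable_on cbox a b" for a b
    by (rule integrable_on_subcbox) simp
  then obtain N where "negligible N" and
    N: "\<And>s e. s \<notin> N \<Longrightarrow> 0 < e \<Longrightarrow> \<exists>\<delta>>0. \<forall>h. 0 < h \<and> h < \<delta> \<longrightarrow>
          norm (integral (cbox s (s + h *\<^sub>R One)) w' /\<^sub>R h ^ DIM(real) - w' s) < e"
    using integrable_ccontinuous_explicit[of w'] by blast
  show ?thesis
  proof
    fix s assume s: "s \<in> {c..d} - N"
    have "integral {s..s + inverse (real (Suc n))} w' = integral {s..s + inverse (real (Suc n))} w" for n
    proof (rule integral_cong)
      fix r assume "r \<in> {s..s + inverse (real (Suc n))}"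
      moreover have "inverse (real (Suc n)) \<le> 1" by (simp add: field_simps)
      ultimately show "w' r = w r" using s by (auto simp: w'_def)
    qed
    moreover have "(\<lambda>n. real (Suc n) *\<^sub>R integral {s..s + inverse (real (Suc n))} w') \<longlonglongrightarrow> w' s"
    proof (rule LIMSEQ_I)
      fix e :: real assume "e > 0"
      with N[of s e] s obtain \<delta> where "\<delta> > 0" and
        \<delta>: "\<And>h. 0 < h \<Longrightarrow> h < \<delta> \<Longrightarrow> norm (integral {s..s + h} w' /\<^sub>R h - w' s) < e" by auto
      obtain k where k: "inverse (real (Suc k)) < \<delta>"
        using reals_Archimedean[OF \<open>\<delta> > 0\<close>] by auto
      have "norm (real (Suc n) *\<^sub>R integral {s..s + inverse (real (Suc n))} w' - w' s) < e" if "n \<ge> k" for n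
      proof -
        have "inverse (real (Suc n)) \<le> inverse (real (Suc k))" using that by (simp add: field_simps)
        with k have "inverse (real (Suc n)) < \<delta>" by (rule le_less_trans[rotated])
        then show ?thesis using \<delta>[of "inverse (real (Suc n))"] by (simp del: of_nat_Suc)
      qed
      then show "\<exists>k. \<forall>n\<ge>k. norm (real (Suc n) *\<^sub>R integral {s..s + inverse (real (Suc n))} w' - w' s) < e"
        by blast
    qed
    moreover have "w' s = w s" using s by (simp add: w'_def)
    ultimately show "(\<lambda>n. real (Suc n) *\<^sub>R integral {s..s + inverse (real (Suc n))} w) \<longlonglongrightarrow> w s"
      by simp
  qed fact
qed

text \<open>
  Avoids differentiating \<open>F\<close>, which is only known to be continuous: the hypothesis is integrated over
  \<open>s\<close> with \<open>t = s + h\<close> and divided by \<open>h\<close>. As \<open>h \<rightarrow> 0\<close> the right-hand side tends to \<open>F d - F c\<close>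
  by telescoping, the left-hand side by Lebesgue differentiation and dominated convergence.
\<close>

lemma integral_subgradient_le:
  fixes u w :: "real \<Rightarrow> 'a::euclidean_space" and F :: "real \<Rightarrow> real"
  assumes "c \<le> d" and cont: "continuous_on {c..d + 1} F"
    and u: "u \<in> borel_measurable (lebesgue_on {c..d})" "\<And>s. s \<in> {c..d} \<Longrightarrow> norm (u s) \<le> C"
    and w: "w integrable_on {c..d + 1}" "\<And>s. s \<in> {c..d + 1} \<Longrightarrow> norm (w s) \<le> K"
    and sub: "\<And>s t. \<lbrakk>c \<le> s; s \<le> d; s < t; t \<le> d + 1\<rbrakk> \<Longrightarrow> u s \<bullet> integral {s..t} w \<le> F t - F s"
  shows "integral {c..d} (\<lambda>s. u s \<bullet> w s) \<le> F d - F c"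
proof -
  obtain N where "negligible N" and
    N: "\<And>s. s \<in> {c..d} - N \<Longrightarrow>
      (\<lambda>n. real (Suc n) *\<^sub>R integral {s..s + inverse (real (Suc n))} w) \<longlonglongrightarrow> w s"
    using right_average_tendsto_ae[OF w(1)] by blast
  define h where "h n = inverse (real (Suc n))" for n
  have h: "0 < h n" "h n \<le> 1" "real (Suc n) * h n = 1" for n
    by (auto simp: h_def field_simps)
  define W where "W t = integral {c..t} w" for t
  have W: "integral {s..t} w = W t - W s" if "c \<le> s" "s \<le> t" "t \<le> d + 1" for s t
  proof -
    have "w integrable_on {c..t}" using that by (intro integrable_subinterval_real[OF w(1)]) auto
    from Henstock_Kurzweil_Integration.integral_combine[OF that(1,2) this] show ?thesis by (simp add: W_def algebra_simps)
  qed
  have contW: "continuous_on {c..d + 1} W"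
    unfolding W_def by (rule indefinite_integral_continuous_1[OF w(1)])
  \<comment> \<open>This is the left-hand side of \<open>sub\<close> at \<open>t = s + h n\<close>,
    divided by \<open>h n\<close>.\<close>
  define f where "f n s = u s \<bullet> (real (Suc n) *\<^sub>R integral {s..s + h n} w)" for n s
  have K: "0 \<le> K" using order_trans[OF norm_ge_zero w(2)[of c]] \<open>c \<le> d\<close> by auto
  have bound: "norm (f n s) \<le> C * K" if s: "s \<in> {c..d}" for n s
  proof -
    have "norm (integral {s..s + h n} w) \<le> K * measure lborel {s..s + h n}"
      using h[of n] s K
      by (intro has_integral_bound_real[where S = "{}", OF _ _ integrable_integral[OF integrable_subinterval_real[OF w(1)]]] w(2)) auto
    then have "norm (integral {s..s + h n} w) \<le> K * h n" using h[of n] by simp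
    then have "real (Suc n) * norm (integral {s..s + h n} w) \<le> real (Suc n) * (K * h n)"
      by (rule mult_left_mono) simp
    also have "\<dots> = K" using h(3)[of n] by (simp only: mult.left_commute[of _ K] mult_1_right)
    finally have "real (Suc n) * norm (integral {s..s + h n} w) \<le> K" .
    then have "norm (u s) * norm (real (Suc n) *\<^sub>R integral {s..s + h n} w) \<le> C * K"
      using u(2)[OF s] order_trans[OF norm_ge_zero u(2)[OF s]] by (intro mult_mono) auto
    with Cauchy_Schwarz_ineq2[of "u s"] show ?thesis
      unfolding f_def real_norm_def by (rule order_trans)
  qed
  have intf: "f n integrable_on {c..d}" for n
  proof (rule measurable_bounded_by_integrable_imp_integrable)
    \<comment> \<open>Writing the integral of \<open>w\<close> as an increment of its primitive
      exhibits \<open>f n\<close> as the inner product of a measurable and a continuous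
      function.\<close>
    have "continuous_on {c..d} (\<lambda>s. real (Suc n) *\<^sub>R (W (s + h n) - W s))"
      using h[of n] by (intro continuous_intros continuous_on_compose2[OF contW]) auto
    then have "(\<lambda>s. u s \<bullet> (real (Suc n) *\<^sub>R (W (s + h n) - W s))) \<in> borel_measurable (lebesgue_on {c..d})"
      by (intro borel_measurable_inner u(1) continuous_imp_measurable_on_sets_lebesgue) auto
    also have "?this \<longleftrightarrow> f n \<in> borel_measurable (lebesgue_on {c..d})"
      using h[of n] by (intro measurable_cong) (auto simp: f_def W)
    finally show "f n \<in> borel_measurable (lebesgue_on {c..d})" .
  qed (use bound in auto)
  \<comment> \<open>Setting the integrands to 0 on \<open>N\<close> turns almost everywhere
    convergence into convergence at every point and changes no integral.\<close>
  have "(\<lambda>n. integral {c..d} (\<lambda>s. if s \<in> N then 0 else f n s)) \<longlonglongrightarrow>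
      integral {c..d} (\<lambda>s. if s \<in> N then 0 else u s \<bullet> w s)"
  proof (rule dominated_convergence(2))
    show "(\<lambda>s. if s \<in> N then 0 else f n s) integrable_on {c..d}" for n
      by (rule integrable_spike[OF intf \<open>negligible N\<close>, of _ n]) auto
    show "(\<lambda>s. C * K) integrable_on {c..d}" by (rule integrable_const_ivl)
    show "norm (if s \<in> N then 0 else f n s) \<le> C * K" if "s \<in> {c..d}" for n s
      using bound[OF that, of n] norm_ge_zero[of "f n s"] by (auto intro: order_trans)
    show "(\<lambda>n. if s \<in> N then 0 else f n s) \<longlonglongrightarrow> (if s \<in> N then 0 else u s \<bullet> w s)" if "s \<in> {c..d}" for s
      using tendsto_inner[OF tendsto_const N] that by (auto simp: f_def h_def)
  qed
  also have "integral {c..d} (\<lambda>s. if s \<in> N then 0 else u s \<bullet> w s) = integral {c..d} (\<lambda>s. u s \<bullet> w s)"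
    by (rule integral_spike[OF \<open>negligible N\<close>]) auto
  also have "(\<lambda>n. integral {c..d} (\<lambda>s. if s \<in> N then 0 else f n s)) = (\<lambda>n. integral {c..d} (f n))"
    by (intro ext integral_spike[OF \<open>negligible N\<close>]) auto
  finally have lim: "(\<lambda>n. integral {c..d} (f n)) \<longlonglongrightarrow> integral {c..d} (\<lambda>s. u s \<bullet> w s)" .
  show ?thesis
  proof (rule LIMSEQ_le[OF lim integral_right_differences_tendsto[OF \<open>c \<le> d\<close> cont]], intro exI allI impI)
    fix n
    show "integral {c..d} (f n) \<le>
        integral {c..d} (\<lambda>s. real (Suc n) * (F (s + inverse (real (Suc n))) - F s))"
    proof (rule integral_le[OF intf])
      show "(\<lambda>s. real (Suc n) * (F (s + inverse (real (Suc n))) - F s)) integrable_on {c..d}"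
        using h[of n] unfolding h_def[symmetric]
        by (intro integrable_continuous_real continuous_intros continuous_on_compose2[OF cont]) auto
      show "f n s \<le> real (Suc n) * (F (s + inverse (real (Suc n))) - F s)" if "s \<in> {c..d}" for s
        using mult_left_mono[OF sub[of s "s + h n"], of "real (Suc n)"] that h[of n]
        by (simp add: f_def h_def)
    qed
  qed
qed


text \<open>
  The reverse inequality is the previous lemma in reversed time.
\<close>

lemma integral_subgradient_eq:
  fixes u w W :: "real \<Rightarrow> 'a::euclidean_space" and F :: "real \<Rightarrow> real"
  assumes "a \<le> c - 1" "c \<le> d" "d + 1 \<le> b"
    and u: "u \<in> borel_measurable (lebesgue_on {a..b})" "\<And>s. s \<in> {a..b} \<Longrightarrow> norm (u s) \<le> C"
    and w: "w integrable_on {a..b}" "\<And>s. s \<in> {a..b} \<Longrightarrow> norm (w s) \<le> K"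
    and W: "\<And>s t. \<lbrakk>a \<le> s; s \<le> t; t \<le> b\<rbrakk> \<Longrightarrow> W t - W s = integral {s..t} w"
    and sub: "\<And>s t. \<lbrakk>s \<in> {a..b}; t \<in> {a..b}\<rbrakk> \<Longrightarrow> u s \<bullet> (W t - W s) \<le> F t - F s"
  shows "integral {c..d} (\<lambda>s. u s \<bullet> w s) = F d - F c"
proof -
  have contW: "continuous_on {a..b} W"
  proof (rule continuous_on_eq)
    show "continuous_on {a..b} (\<lambda>t. W a + integral {a..t} w)"
      by (intro continuous_intros indefinite_integral_continuous_1[OF w(1)])
    show "W a + integral {a..t} w = W t" if "t \<in> {a..b}" for t
      using W[of a t] that by (auto simp: algebra_simps)
  qed
  have C: "0 \<le> C" using order_trans[OF norm_ge_zero u(2)[of a]] assms(1-3) by auto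
  \<comment> \<open>Used in both orders of \<open>s\<close> and \<open>t\<close>, this bounds the
    increments of \<open>F\<close> by \<open>C\<close> times those of \<open>W\<close>, so
    \<open>F\<close> inherits continuity from \<open>W\<close>.\<close>
  have diff: "F s - F t \<le> C * norm (W t - W s)" if "s \<in> {a..b}" "t \<in> {a..b}" for s t
  proof -
    have "- (C * norm (W t - W s)) \<le> u s \<bullet> (W t - W s)"
      using Cauchy_Schwarz_ineq2[of "u s" "W t - W s"]
        mult_right_mono[OF u(2)[OF that(1)] norm_ge_zero[of "W t - W s"]] by linarith
    with sub[OF that] show ?thesis by linarith
  qed
  have cont: "continuous_on {a..b} F"
    unfolding continuous_on_def
  proof
    fix s assume s: "s \<in> {a..b}"
    have "((\<lambda>t. C * norm (W t - W s)) \<longlongrightarrow> C * norm (W s - W s)) (at s within {a..b})"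
      using contW s by (intro tendsto_intros) (auto simp: continuous_on_def)
    then have "((\<lambda>t. C * norm (W t - W s)) \<longlongrightarrow> 0) (at s within {a..b})" by simp
    moreover have "\<forall>\<^sub>F t in at s within {a..b}. norm (F t - F s) \<le> C * norm (W t - W s)"
      unfolding eventually_at_filter
      using diff[OF s] diff[OF _ s] by (auto simp: norm_minus_commute abs_le_iff)
    ultimately show "(F \<longlongrightarrow> F s) (at s within {a..b})"
      by (subst LIM_zero_iff[symmetric]) (rule Lim_null_comparison)
  qed
  have "integral {c..d} (\<lambda>s. u s \<bullet> w s) \<le> F d - F c"
  proof (rule integral_subgradient_le[OF \<open>c \<le> d\<close>])
    show "u \<in> borel_measurable (lebesgue_on {c..d})"
      by (rule measurable_restrict_mono[OF u(1)]) (use assms(1-3) in auto)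
    show "u s \<bullet> integral {s..t} w \<le> F t - F s" if "c \<le> s" "s \<le> d" "s < t" "t \<le> d + 1" for s t
      using sub[of s t] W[of s t] that assms(1-3) by simp
  qed (use assms(1-3) in \<open>auto intro!: continuous_on_subset[OF cont] integrable_subinterval_real[OF w(1)] u(2) w(2)\<close>)
  \<comment> \<open>Under time reversal \<open>u\<close> keeps its sign while the density
    \<open>w\<close> changes sign. The interval \<open>{-d..-c + 1}\<close> reflects
    \<open>{c - 1..d}\<close>, which is where the unit of room to the left of \<open>c\<close>
    enters.\<close>
  moreover have "integral {-d..-c} (\<lambda>s. u (-s) \<bullet> (- w (-s))) \<le> F (- (-c)) - F (- (-d))"
  proof (rule integral_subgradient_le[where F = "\<lambda>s. F (-s)"])
    show "continuous_on {-d..-c + 1} (\<lambda>s. F (-s))"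
      using assms(1-3) by (intro continuous_on_compose2[OF cont] continuous_intros) auto
    show "(\<lambda>s. u (-s)) \<in> borel_measurable (lebesgue_on {-d..-c})"
    \<comment> \<open>Measurability is carried through the reflection by way of integrability: the
      bounded measurable \<open>u\<close> is integrable, and integrability is invariant under
      reflection.\<close>
    proof (rule integrable_imp_measurable)
      have "u \<in> borel_measurable (lebesgue_on {c..d})"
        by (rule measurable_restrict_mono[OF u(1)]) (use assms(1-3) in auto)
      then have "u integrable_on {c..d}"
        by (rule measurable_bounded_by_integrable_imp_integrable[where g = "\<lambda>_. C"])
          (use assms(1-3) in \<open>auto intro: u(2)\<close>)
      then show "(\<lambda>s. u (-s)) integrable_on {-d..-c}" by simp
    qed
    have "w integrable_on {c - 1..d}"
      using assms(1-3) by (intro integrable_subinterval_real[OF w(1)]) auto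
    then show "(\<lambda>s. - w (-s)) integrable_on {-d..-c + 1}"
      using Henstock_Kurzweil_Integration.integrable_reflect_real[where f = w and a = "c - 1" and b = d] by (intro integrable_neg) (simp add: algebra_simps)
    show "u (-s) \<bullet> integral {s..t} (\<lambda>s. - w (-s)) \<le> F (-t) - F (-s)"
      if "-d \<le> s" "s \<le> -c" "s < t" "t \<le> -c + 1" for s t
    proof -
      have "integral {s..t} (\<lambda>s. - w (-s)) = - integral {-t..-s} w"
        using Henstock_Kurzweil_Integration.integral_reflect_real[where f = w and a = "-t" and b = "-s"] by simp
      also have "\<dots> = W (-t) - W (-s)" using W[of "-t" "-s"] that assms(1-3) by (simp add: algebra_simps)
      finally show ?thesis using sub[of "-s" "-t"] that assms(1-3) by simp
    qed
  qed (use assms(1-3) in \<open>auto intro!: u(2) w(2)\<close>)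
  then have "- integral {c..d} (\<lambda>s. u s \<bullet> w s) \<le> F c - F d"
    using Henstock_Kurzweil_Integration.integral_reflect_real[where f = "\<lambda>s. u s \<bullet> w s" and a = c and b = d] by simp
  ultimately show ?thesis by simp
qed

section \<open>Mixed strategies and best replies\<close>

lemma mixed_norm_le_1:
  assumes "p \<in> mixed"
  shows "norm p \<le> 1"
  using norm_le_l1_cart[of p] assms by (auto simp: mixed_def)

lemma axis_in_mixed: "axis k 1 \<in> mixed"
  by (auto simp: mixed_def axis_def)

text \<open>A linear functional on the simplex attains its maximum at a vertex: comparison with the
  unit vectors gives one inequality, and a weighted average of coordinates never exceeds the largest
  one.\<close>

lemma mixed_inner_eq_Max:
  assumes "u \<in> mixed" and "\<And>p. p \<in> mixed \<Longrightarrow> p \<bullet> w \<le> u \<bullet> w"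
  shows "Max (range (($) w)) = u \<bullet> w"
proof (rule antisym)
  show "Max (range (($) w)) \<le> u \<bullet> w"
    using assms(2)[OF axis_in_mixed] by (subst Max_le_iff) (auto simp: inner_axis')
  have "u \<bullet> w \<le> (\<Sum>i\<in>UNIV. u $ i * Max (range (($) w)))"
    unfolding inner_vec_def inner_real_def
    using assms(1) by (intro sum_mono mult_left_mono) (auto simp: mixed_def)
  also have "\<dots> = Max (range (($) w))"
    using assms(1) by (simp add: mixed_def flip: sum_distrib_right)
  finally show "u \<bullet> w \<le> Max (range (($) w))" .
qed

text \<open>Best replies are invariant under positive scaling of the opponent's vector, so the
  average may be replaced by the unnormalised integral.\<close>

lemma BR_A_time_avg_inner_le:
  assumes "u \<in> BR_A M (time_avg v t)" "t > 0" "p \<in> mixed"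
  shows "p \<bullet> (M *v (LINT s|lebesgue_on {0..t}. v s)) \<le> u \<bullet> (M *v (LINT s|lebesgue_on {0..t}. v s))"
proof -
  have "payoff M p (time_avg v t) \<le> payoff M u (time_avg v t)"
    using assms(1,3) by (simp add: BR_A_def is_arg_max_linorder)
  with \<open>t > 0\<close> show ?thesis
    by (simp add: payoff_def time_avg_def matrix_vector_mult_scaleR divide_le_cancel)
qed

text \<open>This makes player B a player A of the transposed matrix.\<close>

lemma BR_B_eq_BR_A: "BR_B M p = BR_A (transpose M) p"
  by (simp add: BR_B_def BR_A_def payoff_def inner_commute flip: dot_lmul_matrix)

section \<open>The empirical joint distribution and its regrets\<close>

lemma integrable_mixed_product:
  fixes u :: "real \<Rightarrow> real ^ 'm" and v :: "real \<Rightarrow> real ^ 'n"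
  assumes "u \<in> borel_measurable (lebesgue_on {0..})" "v \<in> borel_measurable (lebesgue_on {0..})"
    and "\<And>t. t \<ge> 0 \<Longrightarrow> u t \<in> mixed" "\<And>t. t \<ge> 0 \<Longrightarrow> v t \<in> mixed"
  shows "integrable (lebesgue_on {0..t}) (\<lambda>s. u s $ i * v s $ j)"
proof (rule absolutely_integrable_imp_integrable)
  show "(\<lambda>s. u s $ i * v s $ j) absolutely_integrable_on {0..t}"
  proof (rule measurable_bounded_by_integrable_imp_absolutely_integrable)
    have "u \<in> borel_measurable (lebesgue_on {0..t})" "v \<in> borel_measurable (lebesgue_on {0..t})"
      using assms(1,2) by (auto intro: measurable_restrict_mono)
    then show "(\<lambda>s. u s $ i * v s $ j) \<in> borel_measurable (lebesgue_on {0..t})"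
      by (simp add: cart_eq_inner_axis)
    show "norm (u s $ i * v s $ j) \<le> 1" if "s \<in> {0..t}" for s
    proof -
      have "\<bar>u s $ i\<bar> \<le> 1" "\<bar>v s $ j\<bar> \<le> 1"
        using mixed_norm_le_1 assms(3,4) that component_le_norm_cart order_trans
        by (metis atLeastAtMost_iff)+
      then show ?thesis by (simp add: abs_mult mult_le_one)
    qed
  show "{0..t} \<in> sets lebesgue" by simp
    show "(\<lambda>_. 1) integrable_on {0..t}" by (rule integrable_const_ivl)
  qed
qed simp

text \<open>Weights \<open>c i j = 1\<close> yield the total mass, and weights taken from the payoff
  matrix yield both terms of the regret.\<close>

lemma sum_empirical_joint:
  fixes u :: "real \<Rightarrow> real ^ 'm" and v :: "real \<Rightarrow> real ^ 'n"
  assumes "u \<in> borel_measurable (lebesgue_on {0..})" "v \<in> borel_measurable (lebesgue_on {0..})"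
    and "\<And>t. t \<ge> 0 \<Longrightarrow> u t \<in> mixed" "\<And>t. t \<ge> 0 \<Longrightarrow> v t \<in> mixed"
  shows "(\<Sum>i\<in>UNIV. \<Sum>j\<in>UNIV. c i j * empirical_joint u v t $ i $ j) =
    (1 / t) * (LINT s|lebesgue_on {0..t}. (\<Sum>i\<in>UNIV. \<Sum>j\<in>UNIV. c i j * (u s $ i * v s $ j)))"
  using integrable_mixed_product[OF assms]
  by (simp add: empirical_joint_def sum_distrib_left mult.left_commute)

lemma empirical_joint_in_joint_dist:
  fixes u :: "real \<Rightarrow> real ^ 'm" and v :: "real \<Rightarrow> real ^ 'n"
  assumes "u \<in> borel_measurable (lebesgue_on {0..})" "v \<in> borel_measurable (lebesgue_on {0..})"
    and mixed: "\<And>t. t \<ge> 0 \<Longrightarrow> u t \<in> mixed" "\<And>t. t \<ge> 0 \<Longrightarrow> v t \<in> mixed" and "t > 0"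
  shows "empirical_joint u v t \<in> joint_dist"
proof -
  have "(\<Sum>i\<in>UNIV. \<Sum>j\<in>UNIV. empirical_joint u v t $ i $ j) =
    (1 / t) * (LINT s|lebesgue_on {0..t}. (\<Sum>i\<in>UNIV. \<Sum>j\<in>UNIV. u s $ i * v s $ j))"
    using sum_empirical_joint[OF assms(1-4), of "\<lambda>_ _. 1" t] by simp
  also have "(LINT s|lebesgue_on {0..t}. (\<Sum>i\<in>UNIV. \<Sum>j\<in>UNIV. u s $ i * v s $ j)) =
      (LINT s|lebesgue_on {0..t}. 1)"
    using mixed by (intro Bochner_Integration.integral_cong) (auto simp: mixed_def simp flip: sum_product)
  also have "\<dots> = t"
    using \<open>t > 0\<close> by (simp add: lebesgue_integral_eq_integral measure_restrict_space)
  finally have "(\<Sum>i\<in>UNIV. \<Sum>j\<in>UNIV. empirical_joint u v t $ i $ j) = 1" using \<open>t > 0\<close> by simp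
  moreover have "0 \<le> empirical_joint u v t $ i $ j" for i j
    using \<open>t > 0\<close> mixed by (auto simp: empirical_joint_def mixed_def intro!: divide_nonneg_pos Bochner_Integration.integral_nonneg)
  ultimately show ?thesis by (simp add: joint_dist_def)
qed

lemma integrable_mixed:
  fixes v :: "real \<Rightarrow> real ^ 'n"
  assumes "v \<in> borel_measurable (lebesgue_on {0..})" "\<And>t. t \<ge> 0 \<Longrightarrow> v t \<in> mixed"
  shows "integrable (lebesgue_on {0..t}) v"
proof (rule absolutely_integrable_imp_integrable)
  show "v absolutely_integrable_on {0..t}"
  proof (rule measurable_bounded_by_integrable_imp_absolutely_integrable)
    show "v \<in> borel_measurable (lebesgue_on {0..t})"
      by (rule measurable_restrict_mono[OF assms(1)]) auto
    show "norm (v s) \<le> 1" if "s \<in> {0..t}" for s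
      using that by (intro mixed_norm_le_1 assms(2)) simp
  qed auto
qed auto

lemma inner_matrix_vector_mult:
  fixes M :: "real ^ 'n ^ 'm"
  shows "p \<bullet> (M *v q) = (\<Sum>i\<in>UNIV. \<Sum>j\<in>UNIV. M $ i $ j * (p $ i * q $ j))"
  by (simp add: inner_vec_def matrix_vector_mult_def sum_distrib_left mult_ac)

text \<open>In the first term the deviation \<open>i'\<close> ignores \<open>u\<close>, whose
  entries sum to 1, so linearity leaves a payoff against the integral of \<open>v\<close>. The
  second term is independent of \<open>i'\<close>.\<close>

lemma regret_A_empirical_joint:
  fixes M :: "real ^ 'n ^ 'm"
  assumes "u \<in> borel_measurable (lebesgue_on {0..})" "v \<in> borel_measurable (lebesgue_on {0..})"
    and mixed: "\<And>t. t \<ge> 0 \<Longrightarrow> u t \<in> mixed" "\<And>t. t \<ge> 0 \<Longrightarrow> v t \<in> mixed"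
  shows "regret_A M i' (empirical_joint u v t) =
    ((M *v (LINT s|lebesgue_on {0..t}. v s)) $ i' - (LINT s|lebesgue_on {0..t}. u s \<bullet> (M *v v s))) / t"
proof -
  have "(LINT s|lebesgue_on {0..t}. (\<Sum>i\<in>UNIV. \<Sum>j\<in>UNIV. M $ i' $ j * (u s $ i * v s $ j))) =
      (LINT s|lebesgue_on {0..t}. (M *v v s) $ i')"
  proof (rule Bochner_Integration.integral_cong)
    fix s assume "s \<in> space (lebesgue_on {0..t})"
    then have "(\<Sum>i\<in>UNIV. u s $ i) = 1" using mixed(1)[of s] by (simp add: mixed_def)
    moreover have "(\<Sum>i\<in>UNIV. \<Sum>j\<in>UNIV. M $ i' $ j * (u s $ i * v s $ j)) =
        (\<Sum>i\<in>UNIV. u s $ i) * (M *v v s) $ i'"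
      by (simp add: matrix_vector_mult_def sum_product mult_ac)
    ultimately show "(\<Sum>i\<in>UNIV. \<Sum>j\<in>UNIV. M $ i' $ j * (u s $ i * v s $ j)) = (M *v v s) $ i'" by simp
  qed simp
  also have "\<dots> = (M *v (LINT s|lebesgue_on {0..t}. v s)) $ i'"
    using integral_bounded_linear[OF bounded_linear_compose[OF bounded_linear_vec_nth matrix_vector_mul_bounded_linear]
        integrable_mixed[OF assms(2) mixed(2)]] by simp
  finally have 1: "(LINT s|lebesgue_on {0..t}. (\<Sum>i\<in>UNIV. \<Sum>j\<in>UNIV. M $ i' $ j * (u s $ i * v s $ j))) =
    (M *v (LINT s|lebesgue_on {0..t}. v s)) $ i'" .
  show ?thesis
    using sum_empirical_joint[OF assms, of "\<lambda>i j. M $ i' $ j" t]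
      sum_empirical_joint[OF assms, of "\<lambda>i j. M $ i $ j" t]
    by (simp add: regret_A_def 1 inner_matrix_vector_mult diff_divide_distrib)
qed

text \<open>The players are named neutrally so that the result serves player A directly and player B
  after transposing the matrix and exchanging the trajectories.\<close>

lemma Max_regret_A_tendsto_0:
  fixes M :: "real ^ 'n ^ 'm"
  assumes u: "u \<in> borel_measurable (lebesgue_on {0..})" and v: "v \<in> borel_measurable (lebesgue_on {0..})"
    and mixed: "\<And>t. t \<ge> 0 \<Longrightarrow> u t \<in> mixed" "\<And>t. t \<ge> 0 \<Longrightarrow> v t \<in> mixed"
    and br: "\<And>t. t \<ge> 1 \<Longrightarrow> u t \<in> BR_A M (time_avg v t)"
  shows "((\<lambda>t. Max (range (\<lambda>i. regret_A M i (empirical_joint u v t)))) \<longlongrightarrow> 0) at_top"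
proof -
  define w where "w s = M *v v s" for s
  define W where "W t = M *v (LINT s|lebesgue_on {0..t}. v s)" for t
  define G where "G t = (LINT s|lebesgue_on {0..t}. u s \<bullet> w s)" for t
  note intv = integrable_mixed[OF v mixed(2)]
  have intw: "integrable (lebesgue_on {0..t}) w" for t
    unfolding w_def by (rule integrable_bounded_linear[OF matrix_vector_mul_bounded_linear intv])
  have w_on: "w integrable_on {s..t}" if "0 \<le> s" for s t
    using integrable_on_lebesgue_on[OF intw, of t] that
    by (intro integrable_subinterval_real[of w 0 t s t]) auto
  have W_integral: "W t = integral {0..t} w" for t
  proof -
    have "(LINT s|lebesgue_on {0..t}. w s) = W t"
      unfolding W_def w_def by (rule integral_bounded_linear[OF matrix_vector_mul_bounded_linear intv])
    with lebesgue_integral_eq_integral[OF intw, of t] show ?thesis by simp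
  qed
  define K where "K = onorm ((*v) M)"
  have normw: "norm (w s) \<le> K" if "s \<ge> 0" for s
  proof -
    have "norm (w s) \<le> K * norm (v s)"
      unfolding w_def K_def by (rule onorm[OF matrix_vector_mul_bounded_linear])
    also have "\<dots> \<le> K * 1"
      unfolding K_def using that
      by (intro mult_left_mono mixed_norm_le_1 mixed onorm_pos_le matrix_vector_mul_bounded_linear)
    finally show ?thesis by simp
  qed
  have uw: "integrable (lebesgue_on {0..t}) (\<lambda>s. u s \<bullet> w s)" for t
    unfolding w_def inner_matrix_vector_mult
    by (intro Bochner_Integration.integrable_sum integrable_mult_right integrable_mixed_product[OF u v mixed])
  have G_diff: "G t - G s = integral {s..t} (\<lambda>s. u s \<bullet> w s)" if "0 \<le> s" "s \<le> t" for s t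
  proof -
    have "G t = integral {0..t} (\<lambda>s. u s \<bullet> w s)" for t
      unfolding G_def by (rule lebesgue_integral_eq_integral[OF uw]) simp
    then show ?thesis
      using Henstock_Kurzweil_Integration.integral_combine[OF that integrable_on_lebesgue_on[OF uw]]
      by (simp add: algebra_simps)
  qed
  have opt: "p \<bullet> W t \<le> u t \<bullet> W t" if "t \<ge> 1" "p \<in> mixed" for t p
    unfolding W_def using BR_A_time_avg_inner_le[OF br[OF that(1)] _ that(2)] that by simp
  \<comment> \<open>Best replies begin at time 1 and the subgradient identity needs a unit of room
    before its interval, hence the base time 2.\<close>
  have envelope: "u t \<bullet> W t - G t = u 2 \<bullet> W 2 - G 2" if "t \<ge> 2" for t
  proof -
    have "integral {2..t} (\<lambda>s. u s \<bullet> w s) = u t \<bullet> W t - u 2 \<bullet> W 2"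
    proof (rule integral_subgradient_eq[where a = 1 and b = "t + 1" and C = 1 and K = K and W = W])
      show "u \<in> borel_measurable (lebesgue_on {1..t + 1})"
        by (rule measurable_restrict_mono[OF u]) auto
      show "W r - W s = integral {s..r} w" if "1 \<le> s" "s \<le> r" for s r
        using Henstock_Kurzweil_Integration.integral_combine[OF _ that(2) w_on, of 0] that
        by (simp add: W_integral algebra_simps)
      \<comment> \<open>At time \<open>r\<close> the strategy \<open>u s\<close> is one of the
        competitors of the best reply \<open>u r\<close>.\<close>
      show "u s \<bullet> (W r - W s) \<le> u r \<bullet> W r - u s \<bullet> W s" if "s \<in> {1..t + 1}" "r \<in> {1..t + 1}" for r s
        using opt[of r "u s"] mixed(1)[of s] that by (simp add: inner_diff_right)
    qed (use that in \<open>auto intro!: normw w_on mixed_norm_le_1 mixed\<close>)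
    with G_diff[of 2 t] that show ?thesis by simp
  qed
  have "((\<lambda>t. (u 2 \<bullet> W 2 - G 2) / t) \<longlongrightarrow> 0) at_top"
    by (intro tendsto_divide_0[OF tendsto_const] filterlim_at_top_imp_at_infinity filterlim_ident)
  moreover have "\<forall>\<^sub>F t in at_top. (u 2 \<bullet> W 2 - G 2) / t =
      Max (range (\<lambda>i. regret_A M i (empirical_joint u v t)))"
    using eventually_ge_at_top[of 2]
  proof eventually_elim
    case (elim t)
    \<comment> \<open>The regrets are the payoffs \<open>W t $ i\<close> under a single increasing
      affine map, and such a map commutes with \<open>Max\<close>.\<close>
    have "range (\<lambda>i. regret_A M i (empirical_joint u v t)) = (\<lambda>z. (z - G t) / t) ` range (($) (W t))"
      using mixed by (auto simp: regret_A_empirical_joint[OF u v] W_def G_def w_def)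
    moreover have "mono (\<lambda>z. (z - G t) / t)"
      using elim by (intro monoI divide_right_mono) auto
    ultimately have "Max (range (\<lambda>i. regret_A M i (empirical_joint u v t))) =
        (Max (range (($) (W t))) - G t) / t"
      using mono_Max_commute[of "\<lambda>z. (z - G t) / t" "range (($) (W t))"] by simp
    also have "Max (range (($) (W t))) = u t \<bullet> W t"
      using elim by (intro mixed_inner_eq_Max mixed opt) auto
    finally show ?case using envelope[OF elim] by simp
  qed
  ultimately show ?thesis by (rule Lim_transform_eventually)
qed

text \<open>Exchanging the trajectories transposes the joint distribution, which matches the
  transposed payoff matrix.\<close>

lemma regret_B_eq_regret_A:
  "regret_B B j' (empirical_joint x y t) = regret_A (transpose B) j' (empirical_joint y x t)"
proof -
  have "empirical_joint x y t $ i $ j = empirical_joint y x t $ j $ i" for i j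
    by (simp add: empirical_joint_def mult.commute)
  then show ?thesis
    unfolding regret_A_def regret_B_def transpose_def
    by (simp add: sum.swap[of _ "UNIV :: 'b set" "UNIV :: 'a set"])
qed

section \<open>Compactness and distance to the limit set\<close>

lemma continuous_on_Max_range:
  fixes f :: "'i::finite \<Rightarrow> 'a::topological_space \<Rightarrow> real"
  assumes "\<And>i. continuous_on S (f i)"
  shows "continuous_on S (\<lambda>x. Max (range (\<lambda>i. f i x)))"
proof -
  have "continuous_on S (\<lambda>x. Max ((\<lambda>i. f i x) ` A))" if "A \<noteq> {}" for A
    using finite[of A] that
  proof (induction rule: finite_ne_induct)
    case (insert i A)
    then show ?case using assms by (auto intro!: continuous_on_max)
  qed (simp add: assms)
  then show ?thesis by simp
qed

text \<open>Outside the \<open>e\<close>-neighbourhood of its zeros, \<open>f\<close> is bounded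
  away from 0 by compactness, so \<open>P t\<close> must eventually enter that neighbourhood. The
  conclusion supplies an actual zero, so along a nontrivial filter it also shows that the zero set
  is nonempty.\<close>

lemma eventually_near_zero_set:
  fixes f :: "'a::metric_space \<Rightarrow> real"
  assumes "compact K" "continuous_on K f" and lim: "((\<lambda>t. f (P t)) \<longlongrightarrow> 0) F"
    and ev: "\<forall>\<^sub>F t in F. P t \<in> K" and "e > 0"
  shows "\<forall>\<^sub>F t in F. \<exists>w\<in>K. f w = 0 \<and> dist (P t) w < e"
proof -
  define K' where "K' = K - (\<Union>w\<in>{w \<in> K. f w = 0}. ball w e)"
  have "compact K'" unfolding K'_def using \<open>compact K\<close> by (intro compact_diff) auto
  have nz: "f p \<noteq> 0" if "p \<in> K'" for p using that \<open>e > 0\<close> by (auto simp: K'_def)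
  have "\<exists>\<delta>>0. \<forall>p\<in>K'. \<delta> \<le> \<bar>f p\<bar>"
  proof (cases "K' = {}")
    case False
    have "continuous_on K' (\<lambda>p. \<bar>f p\<bar>)"
      by (intro continuous_intros continuous_on_subset[OF assms(2)]) (auto simp: K'_def)
    from continuous_attains_inf[OF \<open>compact K'\<close> False this] nz show ?thesis
      by (metis zero_less_abs_iff)
  qed (auto intro: exI[of _ 1])
  then obtain \<delta> where "\<delta> > 0" and \<delta>: "\<And>p. p \<in> K' \<Longrightarrow> \<delta> \<le> \<bar>f p\<bar>" by blast
  have "\<forall>\<^sub>F t in F. \<bar>f (P t)\<bar> < \<delta>"
    using tendstoD[OF lim \<open>\<delta> > 0\<close>] by simp
  with ev show ?thesis
  proof eventually_elim
    case (elim t)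
    then have "P t \<notin> K'" using \<delta>[of "P t"] by auto
    with elim show ?case by (auto simp: K'_def dist_commute)
  qed
qed

lemma compact_joint_dist: "compact (joint_dist :: (real ^ 'n ^ 'm) set)"
proof (rule compact_eq_bounded_closed[THEN iffD2], intro conjI)
  show "bounded (joint_dist :: (real ^ 'n ^ 'm) set)"
  proof (rule boundedI)
    fix P :: "real ^ 'n ^ 'm" assume P: "P \<in> joint_dist"
    have "norm P \<le> (\<Sum>i\<in>UNIV. norm (P $ i))"
      unfolding norm_vec_def[of P] by (rule L2_set_le_sum) simp
    also have "\<dots> \<le> (\<Sum>i\<in>UNIV. \<Sum>j\<in>UNIV. \<bar>P $ i $ j\<bar>)"
      by (intro sum_mono norm_le_l1_cart)
    also have "\<dots> = 1" using P by (simp add: joint_dist_def)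
    finally show "norm P \<le> 1" .
  qed
  show "closed (joint_dist :: (real ^ 'n ^ 'm) set)"
    unfolding joint_dist_def
    by (intro closed_Collect_conj closed_Collect_all closed_Collect_le closed_Collect_eq continuous_intros)
qed

text \<open>Expansion in the basis bounds \<open>N\<close> by its values on basis vectors. This is
  the half of norm equivalence that turns Euclidean closeness into closeness in
  \<open>N\<close>.\<close>

lemma is_norm_le_norm:
  fixes N :: "'a::euclidean_space \<Rightarrow> real"
  assumes "is_norm N"
  obtains C where "C > 0" "\<And>v. N v \<le> C * norm v"
proof
  have N: "N 0 = 0" "\<And>v. 0 \<le> N v" "\<And>c v. N (c *\<^sub>R v) = \<bar>c\<bar> * N v" "\<And>v w. N (v + w) \<le> N v + N w"
    using assms by (auto simp: is_norm_def)
  have sum: "N (sum g A) \<le> (\<Sum>a\<in>A. N (g a))" if "finite A" for g :: "'a \<Rightarrow> 'a" and A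
    using that by (induction rule: finite_induct) (auto simp: N(1) intro: order_trans[OF N(4)])
  \<comment> \<open>The summand 1 makes positivity of the constant immediate.\<close>
  show "N v \<le> (1 + (\<Sum>b\<in>Basis. N b)) * norm v" for v
  proof -
    have "N v = N (\<Sum>b\<in>Basis. (v \<bullet> b) *\<^sub>R b)" by (simp add: euclidean_representation)
    also have "\<dots> \<le> (\<Sum>b\<in>Basis. N ((v \<bullet> b) *\<^sub>R b))" by (rule sum) simp
    also have "\<dots> \<le> (\<Sum>b\<in>Basis. norm v * N b)"
      unfolding N(3) by (intro sum_mono mult_right_mono Basis_le_norm N(2))
    also have "\<dots> \<le> (1 + (\<Sum>b\<in>Basis. N b)) * norm v"
      by (simp add: sum_distrib_left algebra_simps)
    finally show ?thesis .
  qed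
  show "0 < 1 + (\<Sum>b\<in>Basis. N b)" using sum_nonneg[of Basis N] N(2) by simp
qed

lemma norm_setdist_tendsto_0:
  fixes P :: "'b \<Rightarrow> 'a::euclidean_space"
  assumes "is_norm N" and near: "\<And>e. e > 0 \<Longrightarrow> \<forall>\<^sub>F t in F. \<exists>w\<in>S. dist (P t) w < e"
  shows "((\<lambda>t. norm_setdist N (P t) S) \<longlongrightarrow> 0) F"
proof (rule order_tendstoI)
  fix a :: ereal assume "a < 0"
  moreover have "0 \<le> norm_setdist N (P t) S" for t
    unfolding norm_setdist_def using assms(1) by (intro INF_greatest) (auto simp: is_norm_def)
  ultimately have "a < norm_setdist N (P t) S" for t by (rule less_le_trans)
  then show "\<forall>\<^sub>F t in F. a < norm_setdist N (P t) S" by simp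
next
  fix a :: ereal assume "0 < a"
  \<comment> \<open>The bound \<open>a\<close> may be infinite, so a real number is chosen strictly
    between 0 and \<open>a\<close>.\<close>
  then obtain e where "0 < e" "ereal e < a"
    using ereal_dense2[of 0 a] by (metis ereal_less(2))
  obtain C where "C > 0" and C: "\<And>v. N v \<le> C * norm v"
    using is_norm_le_norm[OF assms(1)] by blast
  have "\<forall>\<^sub>F t in F. \<exists>w\<in>S. dist (P t) w < e / C"
    using \<open>0 < e\<close> \<open>C > 0\<close> by (intro near) simp
  then show "\<forall>\<^sub>F t in F. norm_setdist N (P t) S < a"
  proof eventually_elim
    case (elim t)
    then obtain w where "w \<in> S" "norm (P t - w) < e / C" by (auto simp: dist_norm)
    then have "N (P t - w) < e"
      using C[of "P t - w"] \<open>C > 0\<close> by (simp add: field_simps)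
    then have "ereal (N (P t - w)) < a" using \<open>ereal e < a\<close> less_trans ereal_less_eq(3) by (metis less_ereal.simps(1))
    with \<open>w \<in> S\<close> show ?case
      unfolding norm_setdist_def by (auto intro: le_less_trans[OF INF_lower])
  qed
qed

text \<open>A maximum equal to 0 says both that no regret is positive and that some regret vanishes.
  The vanishing indices of the two players are found separately and together form the pair required
  by the limit set.\<close>

lemma FP_limit_setI:
  assumes "P \<in> joint_dist" "Max (range (\<lambda>i. regret_A A i P)) = 0" "Max (range (\<lambda>j. regret_B B j P)) = 0"
  shows "P \<in> FP_limit_set A B"
proof -
  have "regret_A A i P \<le> 0" "regret_B B j P \<le> 0" for i j
    using assms(2,3) Max_ge[of "range (\<lambda>i. regret_A A i P)"] Max_ge[of "range (\<lambda>j. regret_B B j P)"]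
    by (auto simp del: Max_ge)
  moreover obtain i j where "regret_A A i P = 0" "regret_B B j P = 0"
    using assms(2,3) Max_in[of "range (\<lambda>i. regret_A A i P)"] Max_in[of "range (\<lambda>j. regret_B B j P)"]
    by force
  ultimately show ?thesis
    using assms(1) by (auto simp: FP_limit_set_def CCE_def regret_A_def regret_B_def)
qed

theorem theorem2p2:
  fixes A B :: "real ^ 'n ^ 'm"
    and x :: "real \<Rightarrow> real ^ 'm"
    and y :: "real \<Rightarrow> real ^ 'n"
  assumes "fictitious_play A B x y"
  shows "(\<forall>N. is_norm N \<longrightarrow>
            ((\<lambda>t. norm_setdist N (empirical_joint x y t) (FP_limit_set A B)) \<longlongrightarrow> 0) at_top)
       \<and> FP_limit_set A B \<subseteq> CCE A B
       \<and> (\<forall>i'. Limsup at_top (\<lambda>t. ereal (regret_A A i' (empirical_joint x y t))) \<le> 0)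
       \<and> (\<forall>j'. Limsup at_top (\<lambda>t. ereal (regret_B B j' (empirical_joint x y t))) \<le> 0)"
proof -
  let ?P = "empirical_joint x y"
  define rA where "rA P = Max (range (\<lambda>i. regret_A A i P))" for P
  define rB where "rB P = Max (range (\<lambda>j. regret_B B j P))" for P
  have meas: "x \<in> borel_measurable (lebesgue_on {0..})" "y \<in> borel_measurable (lebesgue_on {0..})"
    and mixed: "\<And>t. t \<ge> 0 \<Longrightarrow> x t \<in> mixed" "\<And>t. t \<ge> 0 \<Longrightarrow> y t \<in> mixed"
    and br: "\<And>t. t \<ge> 1 \<Longrightarrow> x t \<in> BR_A A (time_avg y t)"
      "\<And>t. t \<ge> 1 \<Longrightarrow> y t \<in> BR_A (transpose B) (time_avg x t)"
    using assms by (auto simp: fictitious_play_def BR_B_eq_BR_A)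
  have limA: "((\<lambda>t. rA (?P t)) \<longlongrightarrow> 0) at_top"
    unfolding rA_def using meas mixed br(1) by (rule Max_regret_A_tendsto_0)
  have limB: "((\<lambda>t. rB (?P t)) \<longlongrightarrow> 0) at_top"
    unfolding rB_def regret_B_eq_regret_A
    using meas(2,1) mixed(2,1) br(2) by (rule Max_regret_A_tendsto_0)
  \<comment> \<open>The sum of absolute values merges the two conditions into one function whose
    zeros are the common zeros of \<open>rA\<close> and \<open>rB\<close>.\<close>
  have cont: "continuous_on joint_dist (\<lambda>P. \<bar>rA P\<bar> + \<bar>rB P\<bar>)"
    unfolding rA_def rB_def regret_A_def regret_B_def
    by (intro continuous_intros continuous_on_Max_range)
  have "((\<lambda>t. \<bar>rA (?P t)\<bar> + \<bar>rB (?P t)\<bar>) \<longlongrightarrow> 0) at_top"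
    using tendsto_add[OF tendsto_rabs[OF limA] tendsto_rabs[OF limB]] by simp
  moreover have "\<forall>\<^sub>F t in at_top. ?P t \<in> joint_dist"
    using eventually_gt_at_top[of 0]
    by eventually_elim (rule empirical_joint_in_joint_dist[OF meas mixed])
  ultimately have zero: "\<forall>\<^sub>F t in at_top. \<exists>w\<in>joint_dist. \<bar>rA w\<bar> + \<bar>rB w\<bar> = 0 \<and> dist (?P t) w < e"
    if "e > 0" for e
    using that by (rule eventually_near_zero_set[OF compact_joint_dist cont])
  have "w \<in> FP_limit_set A B" if "w \<in> joint_dist" "\<bar>rA w\<bar> + \<bar>rB w\<bar> = 0" for w
    using that abs_ge_zero[of "rA w"] abs_ge_zero[of "rB w"]
    by (intro FP_limit_setI) (simp_all add: add_nonneg_eq_0_iff flip: rA_def rB_def)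
  then have near: "\<forall>\<^sub>F t in at_top. \<exists>w\<in>FP_limit_set A B. dist (?P t) w < e" if "e > 0" for e
    by (blast intro: eventually_mono[OF zero[OF that]])
  \<comment> \<open>Each single regret is dominated by the maximal one, which converges to
    0.\<close>
  have Limsup: "Limsup at_top (\<lambda>t. ereal (g t)) \<le> 0"
    if "\<And>t. g t \<le> r t" "(r \<longlongrightarrow> 0) at_top" for g r :: "real \<Rightarrow> real"
  proof -
    have "Limsup at_top (\<lambda>t. ereal (g t)) \<le> Limsup at_top (\<lambda>t. ereal (r t))"
      using that(1) by (intro Limsup_mono) simp
    also have "\<dots> = ereal 0"
      using that(2) by (intro lim_imp_Limsup tendsto_ereal) auto
    finally show ?thesis by (simp add: zero_ereal_def)
  qed
  show ?thesis
  proof (intro conjI allI impI)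
    show "((\<lambda>t. norm_setdist N (?P t) (FP_limit_set A B)) \<longlongrightarrow> 0) at_top" if "is_norm N" for N
      using that near by (rule norm_setdist_tendsto_0)
    show "FP_limit_set A B \<subseteq> CCE A B" by (auto simp: FP_limit_set_def)
    show "Limsup at_top (\<lambda>t. ereal (regret_A A i' (?P t))) \<le> 0" for i'
      by (rule Limsup[OF _ limA]) (simp add: rA_def)
    show "Limsup at_top (\<lambda>t. ereal (regret_B B j' (?P t))) \<le> 0" for j'
      by (rule Limsup[OF _ limB]) (simp add: rB_def)
  qed
qed

end
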